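(* Let $A$ be an associative algebra over a commutative ring with unity, generated by $l$ elements $a_1,\dots,a_l$ and satisfying an admissible polynomial identity of degree $n$. Let $Y$ be the set of (images in $A$ of) nonempty words in $a_1,\dots,a_l$ of length less than $n$. Then the essential height of $A$ over $Y$ is less than $$8(l+1)^n n^5(n-1).$$
   Context: A polynomial identity $f=0$ of $A$ is admissible if the coefficient of one of the highest-degree monomials of $f$ equals $1$; its degree is $\deg f$. The essential height of $A$ over a finite set $Y$ is the minimal $h$ for which there exists a finite set $D\subset A$ such that $A$ is linearly spanned by products $t_1t_2\cdots t_m$ with $m\le 2h+1$, where for each $i$ either $t_i\in D$ or $t_i=y_i^{k_i}$ with $y_i\in Y$, $k_i\ge1$, and the number of indices $i$ with $t_i\notin D$ is at most $h$.
   Formalization: The degree n is assumed to be at least 2: for n = 1 the identity forces A = 0, whose essential height is 0, while the bound is also 0, so the strict inequality fails. Algebras need not have a unit, and identities have no constant term. *)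

theory Defs
  imports Main "HOL-Library.Poly_Mapping" "HOL-Library.Extended_Nat"
begin

text \<open>Associative algebras over a commutative ring with unity, not assumed to have a unit
  themselves.\<close>

locale assoc_algebra = module scale
  for scale :: "'r::comm_ring_1 \<Rightarrow> 'a::ring \<Rightarrow> 'a" +
  assumes scale_mult_left: "scale r x * y = scale r (x * y)"
    and scale_mult_right: "x * scale r y = scale r (x * y)"

text \<open>The product of a nonempty list.  There is no empty product in an algebra without unit:
  the value at \<^term>\<open>[]\<close> is a dummy, and every use below is restricted to nonempty lists.\<close>

fun word_prod :: "'a::ring list \<Rightarrow> 'a" where
  "word_prod [] = 0"
| "word_prod [x] = x"
| "word_prod (x # y # ys) = x * word_prod (y # ys)"

definition subalgebra :: "('r::comm_ring_1 \<Rightarrow> 'a::ring \<Rightarrow> 'a) \<Rightarrow> 'a set \<Rightarrow> bool" where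
  "subalgebra scale S \<longleftrightarrow> module.subspace scale S \<and> (\<forall>x\<in>S. \<forall>y\<in>S. x * y \<in> S)"

definition generates :: "('r::comm_ring_1 \<Rightarrow> 'a::ring \<Rightarrow> 'a) \<Rightarrow> 'a set \<Rightarrow> bool" where
  "generates scale G \<longleftrightarrow> subalgebra scale hull G = UNIV"

text \<open>An element of the free associative algebra on countably many variables is a finitely
  supported coefficient function on words; a word is the list of indices of its variables.\<close>

type_synonym 'r nc_poly = "nat list \<Rightarrow>\<^sub>0 'r"

definition nc_degree :: "'r::zero nc_poly \<Rightarrow> nat" where
  "nc_degree f = Max (length ` Poly_Mapping.keys f)"

definition nc_eval ::
  "('r::comm_ring_1 \<Rightarrow> 'a::ring \<Rightarrow> 'a) \<Rightarrow> (nat \<Rightarrow> 'a) \<Rightarrow> 'r nc_poly \<Rightarrow> 'a" where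
  "nc_eval scale x f =
     (\<Sum>w\<in>Poly_Mapping.keys f. scale (Poly_Mapping.lookup f w) (word_prod (map x w)))"

text \<open>Identities are taken in the free algebra without unit: \<^term>\<open>f\<close> has no constant term.\<close>

definition polynomial_identity ::
  "('r::comm_ring_1 \<Rightarrow> 'a::ring \<Rightarrow> 'a) \<Rightarrow> 'r nc_poly \<Rightarrow> bool" where
  "polynomial_identity scale f \<longleftrightarrow>
     [] \<notin> Poly_Mapping.keys f \<and> (\<forall>x. nc_eval scale x f = 0)"

definition admissible :: "'r::comm_ring_1 nc_poly \<Rightarrow> bool" where
  "admissible f \<longleftrightarrow>
     (\<exists>w\<in>Poly_Mapping.keys f. length w = nc_degree f \<and> Poly_Mapping.lookup f w = 1)"

definition height_products :: "'a::ring set \<Rightarrow> 'a set \<Rightarrow> nat \<Rightarrow> 'a set" where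
  "height_products Y D h =
     {word_prod ts | ts. ts \<noteq> [] \<and> length ts \<le> 2 * h + 1 \<and>
        (\<forall>t\<in>set ts. t \<in> D \<or> (\<exists>y\<in>Y. \<exists>k\<ge>1. t = word_prod (replicate k y))) \<and>
        length (filter (\<lambda>t. t \<notin> D) ts) \<le> h}"

text \<open>The value is \<^term>\<open>\<infinity>\<close> if no such \<^term>\<open>h\<close> exists.\<close>

definition essential_height ::
  "('r::comm_ring_1 \<Rightarrow> 'a::ring \<Rightarrow> 'a) \<Rightarrow> 'a set \<Rightarrow> enat" where
  "essential_height scale Y =
     Inf {enat h | h. \<exists>D. finite D \<and> module.span scale (height_products Y D h) = UNIV}"

definition short_words :: "(nat \<Rightarrow> 'a::ring) \<Rightarrow> nat \<Rightarrow> nat \<Rightarrow> 'a set" where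
  "short_words a l n =
     {word_prod (map a w) | w. w \<noteq> [] \<and> set w \<subseteq> {1..l} \<and> length w < n}"

end

theory Submission
  imports Defs "HOL-Library.Sublist" "HOL-Library.List_Lexorder"
begin

text \<open>Linearizing the identity expresses \<open>t\<^sub>1 \<cdots> t\<^sub>n\<close> through the products of the \<open>t\<^sub>i\<close> in the other
  orders, so \<open>A\<close> is spanned by the words that do not contain a factor \<open>z\<^sub>1 \<cdots> z\<^sub>n\<close> with
  \<open>z\<^sub>1 > \<cdots> > z\<^sub>n\<close> lexicographically (Shirshov). In a block of length \<open>n\<^sup>2 + n\<close> the \<open>n\<close> leftmost windows
  of length \<open>n\<^sup>2\<close> are either pairwise distinct or two of them coincide, and then the block contains
  \<open>u\<^sup>n\<close> with \<open>|u| < n\<close>. Many blocks of the first kind yield a divisible word by the pigeonhole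
  principle, so a nondivisible word is cut, up to pieces of bounded length, into maximal powers of
  words \<open>u\<close> of length less than \<open>n\<close>. If for one \<open>u\<close> there are \<open>n\<close> powers that all break upwards or all
  break downwards, then choosing suitable exponents in front of the breaks makes the word divisible
  again. Hence at most \<open>2 (n - 1)\<close> powers of each of the at most \<open>(l + 1)\<^bsup>n - 1\<^esup>\<close> words \<open>u\<close> occur,
  plus possibly a last one reaching the end of the word. The bounded pieces go into \<open>D\<close>.\<close>

section \<open>Divisible words\<close>

text \<open>A proper prefix is incomparable with its extensions, so a comparison is always settled
  by a letter and survives arbitrary continuations of both words. This allows factors to be extended
  to the right later.\<close>

definition lexless :: "'c::linorder list \<Rightarrow> 'c list \<Rightarrow> bool" where
  "lexless u v \<longleftrightarrow> (\<exists>p x y u' v'. u = p @ x # u' \<and> v = p @ y # v' \<and> x < y)"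

lemma lexless_append: "lexless u v \<Longrightarrow> lexless (u @ s) (v @ t)"
  unfolding lexless_def by (metis append.assoc append_Cons)

lemma lexless_prepend: "lexless u v \<Longrightarrow> lexless (p @ u) (p @ v)"
  unfolding lexless_def by (metis append.assoc)

lemma lexless_prefix: "lexless u v \<Longrightarrow> prefix u u' \<Longrightarrow> prefix v v' \<Longrightarrow> lexless u' v'"
  by (auto simp: prefix_def intro: lexless_append)

lemma lexless_not_Nil: "lexless u v \<Longrightarrow> u \<noteq> [] \<and> v \<noteq> []"
  unfolding lexless_def by auto

lemma lexless_if_less: 
  assumes "u < v" "length u = length v" shows "lexless u v"
  using assms unfolding list_less_def lexord_def lexless_def by auto

text \<open>The relation \<open>lex\<close> compares only lists of equal length, hence is well
  founded over well-founded letters. It carries the induction that rewrites divisible words.\<close>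

lemma lexless_imp_lex:
  "lexless u v \<Longrightarrow> length u = length v \<Longrightarrow> (u, v) \<in> lex {(x, y). x < y}"
  unfolding lexless_def lex_conv by blast

text \<open>Shirshov's n-divisibility. For n >= 2 the factors are automatically nonempty, because
  the empty word is not comparable under \<open>lexless\<close>.\<close>

definition divisible :: "nat \<Rightarrow> 'c::linorder list \<Rightarrow> bool" where
  "divisible n w \<longleftrightarrow> (\<exists>c zs d. w = c @ concat zs @ d \<and> length zs = n \<and>
     sorted_wrt (\<lambda>u v. lexless v u) zs)"

lemma divisible_prepend: "divisible n w \<Longrightarrow> divisible n (c @ w)"
  unfolding divisible_def by (metis append.assoc)

lemma divisible_append: "divisible n w \<Longrightarrow> divisible n (w @ d)"
  unfolding divisible_def by (metis append.assoc)

text \<open>Unlike the factors in \<open>divisible\<close>, these disjoint occurrences may be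
  separated by gaps.\<close>

fun occur_in_order :: "'c list list \<Rightarrow> 'c list \<Rightarrow> bool" where
  "occur_in_order [] w \<longleftrightarrow> True"
| "occur_in_order (f # fs) w \<longleftrightarrow> (\<exists>c r. w = c @ f @ r \<and> occur_in_order fs r)"

lemma occur_in_order_prepend: "occur_in_order fs w \<Longrightarrow> occur_in_order fs (c @ w)"
  by (cases fs) (auto, metis append.assoc)

lemma occur_in_order_concat:
  assumes "subseq bs Bs" "list_all2 sublist fs bs"
  shows "occur_in_order fs (concat Bs)"
  using assms
proof (induction arbitrary: fs rule: list_emb.induct)
  case (list_emb_Nil ys)
  then show ?case by simp
next
  case (list_emb_Cons xs ys y)
  then show ?case by (simp add: occur_in_order_prepend)
next
  case (list_emb_Cons2 x y xs ys)
  then obtain f fs' c d where fs: "fs = f # fs'" "y = c @ f @ d" "list_all2 sublist fs' xs"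
    unfolding list_all2_Cons2 sublist_def by blast
  with list_emb_Cons2 have "occur_in_order fs' (d @ concat ys)"
    by (simp add: occur_in_order_prepend)
  with fs show ?case by auto
qed

text \<open>Every gap is absorbed by the factor on its left, as is the end of the word; the gap
  before the first factor becomes \<open>c\<close>.\<close>

lemma occur_in_order_factorization:
  assumes "occur_in_order fs w" "fs \<noteq> []"
  shows "\<exists>c zs. w = c @ concat zs \<and> list_all2 prefix fs zs"
  using assms
proof (induction fs arbitrary: w)
  case Nil
  then show ?case by simp
next
  case (Cons f fs)
  then obtain c r where w: "w = c @ f @ r" "occur_in_order fs r" by auto
  show ?case
  proof (cases "fs = []")
    case True
    then have "w = c @ concat [f @ r] \<and> list_all2 prefix (f # fs) [f @ r]" using w by simp
    then show ?thesis by blast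
  next
    case False
    with Cons.IH w(2) obtain c' zs where "r = c' @ concat zs" "list_all2 prefix fs zs" by blast
    with w have "w = c @ concat ((f @ c') # zs) \<and> list_all2 prefix (f # fs) ((f @ c') # zs)"
      by simp
    then show ?thesis by blast
  qed
qed

text \<open>Closing the gaps replaces each factor by a right extension of it, which does not affect
  \<open>lexless\<close>.\<close>

lemma divisible_if_occur_in_order:
  assumes "occur_in_order fs w" "sorted_wrt (\<lambda>u v. lexless v u) fs" "fs \<noteq> []"
  shows "divisible (length fs) w"
proof -
  obtain c zs where w: "w = c @ concat zs" and pre: "list_all2 prefix fs zs"
    using occur_in_order_factorization[OF assms(1,3)] by blast
  have "sorted_wrt (\<lambda>u v. lexless v u) zs"
    using assms(2) pre lexless_prefix
    unfolding sorted_wrt_iff_nth_less list_all2_conv_all_nth by (metis order.strict_trans)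
  moreover have "length zs = length fs" using pre by (simp add: list_all2_lengthD)
  moreover have "w = c @ concat zs @ []" using w by simp
  ultimately show ?thesis unfolding divisible_def by blast
qed

section \<open>Unavoidable powers in long nondivisible words\<close>

lemma pigeonhole_filter:
  assumes "finite X" "f ` set xs \<subseteq> X" "card X * m < length xs"
  shows "\<exists>k\<in>X. m < length (filter (\<lambda>x. f x = k) xs)"
proof (rule ccontr)
  assume "\<not> ?thesis"
  then have le: "\<And>k. k \<in> X \<Longrightarrow> length (filter (\<lambda>x. f x = k) xs) \<le> m" by force
  have "length xs = (\<Sum>k\<in>X. length (filter (\<lambda>x. f x = k) xs))"
    using assms(2)
  proof (induction xs)
    case (Cons x xs)
    have "(\<Sum>k\<in>X. length (filter (\<lambda>y. f y = k) (x # xs)))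
      = (\<Sum>k\<in>X. (if f x = k then 1 else 0) + length (filter (\<lambda>y. f y = k) xs))"
      by (intro sum.cong) auto
    then show ?case using Cons assms(1) by (simp add: sum.distrib)
  qed simp
  also have "\<dots> \<le> card X * m" using sum_bounded_above[of X _ m] le by (metis of_nat_id)
  finally show False using assms(3) by simp
qed

text \<open>Agreement of \<open>r\<close> with its shift by \<open>q\<close> means that
  \<open>q\<close> is a period; each induction step peels off one copy of the period from the
  left.\<close>

lemma power_if_overlap:
  assumes "take (k * q) r = take (k * q) (drop q r)" "Suc k * q \<le> length r"
  shows "take (Suc k * q) r = concat (replicate (Suc k) (take q r))"
  using assms
proof (induction k)
  case 0
  then show ?case by simp
next
  case (Suc k)
  have "take (k * q) (take (Suc k * q) r) = take (k * q) (take (Suc k * q) (drop q r))"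
    using Suc.prems(1) by simp
  then have "take (k * q) r = take (k * q) (drop q r)" by (simp add: min_def)
  with Suc.IH Suc.prems(2) have IH: "take (Suc k * q) r = concat (replicate (Suc k) (take q r))"
    by simp
  have "take (Suc (Suc k) * q) r = take q r @ take (Suc k * q) (drop q r)"
    by (metis mult_Suc take_add)
  with Suc.prems(1) IH show ?case by (metis concat.simps(2) replicate_Suc)
qed

text \<open>Two equal windows starting at i < j give the block the period j - i < n on a stretch
  long enough for n repetitions.\<close>

lemma distinct_windows_or_power:
  assumes "length b = n * n + n"
  shows "card ((\<lambda>i. take (n * n) (drop i b)) ` {..<n}) = n \<or>
    (\<exists>d u r. b = d @ concat (replicate n u) @ r \<and> u \<noteq> [] \<and> length u < n)"
proof (cases "inj_on (\<lambda>i. take (n * n) (drop i b)) {..<n}")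
  case True
  then show ?thesis by (simp add: card_image)
next
  case False
  then obtain i j where ij: "i < j" "j < n" and eq: "take (n * n) (drop i b) = take (n * n) (drop j b)"
    unfolding inj_on_def by (metis lessThan_iff nat_neq_iff)
  define q where "q = j - i"
  define r where "r = drop i b"
  have q: "0 < q" "q < n" "j = q + i" using ij by (auto simp: q_def)
  have "take (n * n) r = take (n * n) (drop q r)"
    using eq q by (simp add: r_def)
  then have "take (n * q) (take (n * n) r) = take (n * q) (take (n * n) (drop q r))" by simp
  then have "take (n * q) r = take (n * q) (drop q r)" using q by (simp add: min_def)
  \<comment> \<open>The block length enters here: \<open>Suc n * q + i\<close> equals
    \<open>n * q + j\<close>, where q and j are both below n.\<close>
  moreover have "Suc n * q \<le> length r"
  proof -
    have "n * q + j \<le> n * n + n" using q ij by (intro add_mono mult_le_mono) auto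
    then show ?thesis using assms q by (simp add: r_def)
  qed
  ultimately have "take (Suc n * q) r = concat (replicate (Suc n) (take q r))"
    by (rule power_if_overlap)
  then have "r = concat (replicate (Suc n) (take q r)) @ drop (Suc n * q) r"
    by (metis append_take_drop_id)
  \<comment> \<open>The overlap yields n + 1 copies; the surplus one is moved into the
    remainder.\<close>
  then have "r = concat (replicate n (take q r)) @ (take q r @ drop (Suc n * q) r)"
    by (metis append.assoc append_self_conv concat.simps concat_append replicate_Suc
        replicate_append_same)
  then have "b = take i b @ concat (replicate n (take q r)) @ (take q r @ drop (Suc n * q) r)"
    by (metis append_take_drop_id r_def)
  moreover have "take q r \<noteq> []" "length (take q r) < n"
    using q ij assms by (auto simp: r_def)
  ultimately show ?thesis by blast
qed

lemma blocks_exist: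
  assumes "m * k \<le> length w"
  shows "\<exists>Bs r. w = concat Bs @ r \<and> length Bs = m \<and> (\<forall>b\<in>set Bs. length b = k)"
  using assms
proof (induction m arbitrary: w)
  case 0
  then show ?case by auto
next
  case (Suc m)
  then have "m * k \<le> length (drop k w)" by simp
  from Suc.IH[OF this] obtain Bs r where "drop k w = concat Bs @ r" "length Bs = m"
    "\<forall>b\<in>set Bs. length b = k" by blast
  then have "w = concat (take k w # Bs) @ r \<and> length (take k w # Bs) = Suc m \<and>
    (\<forall>b\<in>set (take k w # Bs). length b = k)"
    using Suc.prems by (auto) (metis append_take_drop_id)
  then show ?case by blast
qed

text \<open>The first \<open>m * k\<close> letters are cut into m blocks. If no block contains a
  power, each has n distinct windows, and m is large enough for n blocks to share the same set of
  windows.\<close>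

lemma divisible_or_power:
  fixes A :: "'c::linorder set"
  assumes "finite A" "0 < n"
  obtains C where "\<And>w. set w \<subseteq> A \<Longrightarrow> C \<le> length w \<Longrightarrow> divisible n w \<or>
    (\<exists>d u r. w = d @ concat (replicate n u) @ r \<and> length d \<le> C \<and> u \<noteq> [] \<and> length u < n)"
proof -
  \<comment> \<open>X contains every possible window set of a block, so its size depends on A and n
    only.\<close>
  define X where "X = Pow {v. set v \<subseteq> A \<and> length v = n * n}"
  have finX: "finite X" using assms by (simp add: X_def finite_lists_length_eq)
  define m where "m = Suc (card X * (n - 1))"
  define k where "k = n * n + n"
  have "divisible n w \<or>
    (\<exists>d u r. w = d @ concat (replicate n u) @ r \<and> length d \<le> m * k \<and> u \<noteq> [] \<and> length u < n)"
    if w: "set w \<subseteq> A" "m * k \<le> length w" for w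
  proof -
    obtain Bs r where Bs: "w = concat Bs @ r" "length Bs = m" "\<forall>b\<in>set Bs. length b = k"
      using blocks_exist[OF w(2)] by blast
    define F where "F b = (\<lambda>i. take (n * n) (drop i b)) ` {..<n}" for b :: "'c list"
    show ?thesis
    proof (cases "\<forall>b\<in>set Bs. card (F b) = n")
      case True
      have "F ` set Bs \<subseteq> X"
      proof
        fix S assume "S \<in> F ` set Bs"
        then obtain b where b: "b \<in> set Bs" "S = F b" by blast
        then have "set b \<subseteq> A" using w Bs by auto
        with b Bs show "S \<in> X"
          by (auto simp: X_def F_def k_def dest: in_set_takeD in_set_dropD)
      qed
      with finX obtain S where S: "S \<in> X" "n - 1 < length (filter (\<lambda>b. F b = S) Bs)"
        using pigeonhole_filter[of X F Bs "n - 1"] Bs(2) by (auto simp: m_def)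
      define bs where "bs = take n (filter (\<lambda>b. F b = S) Bs)"
      have sub: "subseq bs Bs" unfolding bs_def
        by (meson prefix_imp_subseq subseq_filter_left subseq_order.trans take_is_prefix)
      have len: "length bs = n" using S by (simp add: bs_def)
      have mem: "b \<in> set Bs \<and> F b = S" if "b \<in> set bs" for b
        using that by (auto simp: bs_def dest: in_set_takeD)
      have "bs \<noteq> []" using len assms by auto
      then have cardS: "card S = n" using mem[of "hd bs"] True by auto
      have "finite S" using cardS assms by (meson card_ge_0_finite)
      \<comment> \<open>Each selected block contains all of S, so the first can supply the largest
        word of S, the next one the second largest, and so on. Equal lengths turn the strict order
        into \<open>lexless\<close>.\<close>
      define fs where "fs = rev (sorted_list_of_set S)"
      have fs: "set fs = S" "length fs = n" using \<open>finite S\<close> cardS by (auto simp: fs_def)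
      have "sorted_wrt (\<lambda>u v. lexless v u) fs"
        unfolding fs_def sorted_wrt_rev
      proof (rule sorted_wrt_mono_rel[OF _ strict_sorted_list_of_set])
        fix x y assume "x \<in> set (sorted_list_of_set S)" "y \<in> set (sorted_list_of_set S)" "x < y"
        moreover from this have "length x = n * n" "length y = n * n"
          using S(1) \<open>finite S\<close> unfolding X_def by auto
        ultimately show "lexless x y" by (simp add: lexless_if_less)
      qed
      moreover have "list_all2 sublist fs bs"
      proof (rule list_all2_all_nthI)
        show "length fs = length bs" using fs len by simp
        fix i assume i: "i < length fs"
        then have "fs ! i \<in> S" using fs by auto
        also have "S = F (bs ! i)" using mem[of "bs ! i"] i fs len by simp
        finally obtain j where "fs ! i = take (n * n) (drop j (bs ! i))"
          by (auto simp: F_def)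
        then show "sublist (fs ! i) (bs ! i)"
          by (metis append_take_drop_id sublist_appendI)
      qed
      ultimately have "divisible (length fs) (concat Bs)"
        using occur_in_order_concat[OF sub] fs assms by (intro divisible_if_occur_in_order) auto
      then show ?thesis using fs Bs by (simp add: divisible_append)
    next
      case False
      then obtain b where b: "b \<in> set Bs" "card (F b) \<noteq> n" by blast
      with Bs distinct_windows_or_power[of b n] obtain d u s where
        u: "b = d @ concat (replicate n u) @ s" "u \<noteq> []" "length u < n"
        by (auto simp: F_def k_def)
      obtain xs ys where xs: "Bs = xs @ b # ys" using b(1) by (meson split_list)
      have "w = (concat xs @ d) @ concat (replicate n u) @ (s @ concat ys @ r)"
        using Bs xs u by simp
      moreover have "length (concat xs @ d) \<le> m * k"
      proof -
        have "length (concat Bs) = m * k"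
          using Bs(2,3) by (induction Bs arbitrary: m) auto
        then show ?thesis using xs u by simp
      qed
      ultimately show ?thesis using u by blast
    qed
  qed
  then show ?thesis using that by blast
qed

section \<open>Decomposition into powers of short words\<close>

lemma power_past_break:
  assumes "strict_prefix v u" "i < j"
  shows "\<exists>t. concat (replicate j u) @ s = (concat (replicate i u) @ v) @ u ! length v # t"
proof -
  obtain y t where u: "u = v @ y # t" using assms(1) by (rule strict_prefixE')
  obtain m where "j = i + Suc m" using assms(2) less_imp_Suc_add by auto
  then have "j = i + 1 + m" by simp
  then have "concat (replicate j u) @ s
      = (concat (replicate i u) @ v) @ u ! length v # (t @ concat (replicate m u) @ s)"
    using u by (simp only: replicate_add) simp
  then show ?thesis by blast
qed

text \<open>The larger power still follows the period where the smaller one is broken, so the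
  breaking letter alone decides. A letter that is too small makes higher exponents larger; the
  companion lemma treats the opposite direction.\<close>

lemma broken_power_less:
  assumes "strict_prefix v u" "i < j" "c < u ! length v"
  shows "lexless (concat (replicate i u) @ v @ [c]) (concat (replicate j u) @ s)"
  using power_past_break[OF assms(1,2), of s] assms(3) unfolding lexless_def
  by (metis append.assoc)

lemma broken_power_greater:
  assumes "strict_prefix v u" "i < j" "u ! length v < c"
  shows "lexless (concat (replicate j u) @ s) (concat (replicate i u) @ v @ [c])"
  using power_past_break[OF assms(1,2), of s] assms(3) unfolding lexless_def
  by (metis append.assoc)

text \<open>A step \<open>(d, u, k, v, c)\<close> stands for the word \<open>d u\<^sup>k v c\<close>, in which the letter \<open>c\<close> is the
  first one to break the period \<open>u\<close>.\<close>

type_synonym 'c step = "'c list \<times> 'c list \<times> nat \<times> 'c list \<times> 'c"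

fun step_word :: "'c step \<Rightarrow> 'c list" where
  "step_word (d, u, k, v, c) = d @ concat (replicate k u) @ v @ [c]"

text \<open>The bound \<open>n \<le> k\<close> makes every exponent below n available in front of
  the break.\<close>

fun step_ok :: "nat \<Rightarrow> nat \<Rightarrow> 'c step \<Rightarrow> bool" where
  "step_ok C n (d, u, k, v, c) \<longleftrightarrow>
     length d \<le> C \<and> n \<le> k \<and> u \<noteq> [] \<and> length u < n \<and> strict_prefix v u \<and> c \<noteq> u ! length v"

text \<open>The base of the power and the direction of its break. Since \<open>step_ok\<close>
  excludes equality, False means that the breaking letter is too large.\<close>

fun step_key :: "'c::linorder step \<Rightarrow> 'c list \<times> bool" where
  "step_key (d, u, k, v, c) = (u, c < u ! length v)"

text \<open>There are two keys for each base \<open>u\<close>, hence the factor 2. Among n steps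
  with a common key, the i-th supplies a factor consisting of the last \<open>e i\<close> copies of
  \<open>u\<close> together with \<open>v\<close> and \<open>c\<close>.\<close>

lemma divisible_if_many_steps:
  fixes steps :: "'c::linorder step list"
  assumes "finite A" "0 < n" "\<forall>s\<in>set steps. step_ok C n s"
    "set (concat (map step_word steps)) \<subseteq> A"
    "card {u. u \<noteq> [] \<and> set u \<subseteq> A \<and> length u < n} * 2 * (n - 1) < length steps"
  shows "divisible n (concat (map step_word steps))"
proof -
  define U where "U = {u. u \<noteq> [] \<and> set u \<subseteq> A \<and> length u < n}"
  have "U \<subseteq> {u. set u \<subseteq> A \<and> length u \<le> n}" unfolding U_def by auto
  then have "finite U" using finite_lists_length_le[OF assms(1)] finite_subset by blast
  have "step_key ` set steps \<subseteq> U \<times> UNIV"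
  proof
    fix x assume "x \<in> step_key ` set steps"
    then obtain d u k v c where s: "(d, u, k, v, c) \<in> set steps" "x = (u, c < u ! length v)"
      by auto
    then have ok: "step_ok C n (d, u, k, v, c)" using assms(3) by blast
    have "set (step_word (d, u, k, v, c)) \<subseteq> A" using assms(4) s(1) by fastforce
    then have "set u \<subseteq> A" using ok assms(2) by auto
    with ok s(2) show "x \<in> U \<times> UNIV" by (auto simp: U_def)
  qed
  moreover have "card (U \<times> (UNIV :: bool set)) * (n - 1) < length steps"
    using assms(5) by (simp add: U_def card_cartesian_product)
  ultimately obtain key where key: "n - 1 < length (filter (\<lambda>s. step_key s = key) steps)"
    using pigeonhole_filter[of "U \<times> UNIV" step_key steps "n - 1"] \<open>finite U\<close> by auto
  obtain u lt where ult: "key = (u, lt)" by fastforce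
  define ss where "ss = take n (filter (\<lambda>s. step_key s = key) steps)"
  have sub: "subseq (map step_word ss) (map step_word steps)"
    unfolding ss_def
    by (meson subseq_map prefix_imp_subseq subseq_filter_left subseq_order.trans take_is_prefix)
  have len: "length ss = n" using key by (simp add: ss_def)
  have mem: "s \<in> set steps \<and> step_key s = (u, lt)" if "s \<in> set ss" for s
    using that by (auto simp: ss_def ult dest: in_set_takeD)
  \<comment> \<open>The factors must decrease from left to right. With letters that are too small,
    larger exponents give larger words, so the exponents fall; otherwise they rise.\<close>
  define e where "e i = (if lt then n - 1 - i else i)" for i
  define good where "good i f \<longleftrightarrow> (\<exists>v c. f = concat (replicate (e i) u) @ v @ [c] \<and>
      strict_prefix v u \<and> (if lt then c < u ! length v else u ! length v < c) \<and>
      sublist f (step_word (ss ! i)))" for i f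
  have "\<exists>f. good i f" if i: "i < n" for i
  proof -
    obtain d u' k v c where s: "ss ! i = (d, u', k, v, c)" by (metis prod_cases5)
    have "ss ! i \<in> set ss" using i len by simp
    then have "ss ! i \<in> set steps" and key: "step_key (ss ! i) = (u, lt)" using mem by blast+
    with s assms(3) have ok: "step_ok C n (d, u', k, v, c)" by metis
    have u': "u' = u" "lt \<longleftrightarrow> c < u ! length v" using key s by auto
    have "e i < n" using i by (auto simp: e_def)
    then have "e i \<le> k" using ok by simp
    \<comment> \<open>The first m copies of \<open>u\<close> are left to the gap in front of the
      factor.\<close>
    then obtain m where m: "k = m + e i" by (metis le_add_diff_inverse2)
    have "step_word (ss ! i) = (d @ concat (replicate m u)) @ (concat (replicate (e i) u) @ v @ [c]) @ []"
      using s u' m by (simp add: replicate_add)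
    then have "sublist (concat (replicate (e i) u) @ v @ [c]) (step_word (ss ! i))"
      by (metis sublist_appendI)
    moreover have "strict_prefix v u" "if lt then c < u ! length v else u ! length v < c"
      using ok u' by auto
    ultimately show ?thesis unfolding good_def by blast
  qed
  then obtain f where f: "\<And>i. i < n \<Longrightarrow> good i (f i)" by metis
  define fs where "fs = map f [0..<n]"
  have "sorted_wrt (\<lambda>u v. lexless v u) fs"
    unfolding sorted_wrt_iff_nth_less
  proof (intro allI impI)
    fix i j assume ij: "i < j" "j < length fs"
    then have ij': "i < n" "j < n" by (auto simp: fs_def)
    obtain v c where fi: "f i = concat (replicate (e i) u) @ v @ [c]" "strict_prefix v u"
      "if lt then c < u ! length v else u ! length v < c" using f[OF ij'(1)] unfolding good_def by blast
    obtain v' c' where fj: "f j = concat (replicate (e j) u) @ v' @ [c']" "strict_prefix v' u"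
      "if lt then c' < u ! length v' else u ! length v' < c'" using f[OF ij'(2)] unfolding good_def by blast
    have "lexless (f j) (f i)"
    proof (cases lt)
      case True
      then have "e j < e i" using ij ij' by (auto simp: e_def)
      with True fi fj show ?thesis by (simp add: broken_power_less)
    next
      case False
      then have "e i < e j" using ij ij' by (auto simp: e_def)
      with False fi fj show ?thesis by (simp add: broken_power_greater)
    qed
    then show "lexless (fs ! j) (fs ! i)" using ij' by (simp add: fs_def)
  qed
  moreover have "list_all2 sublist fs (map step_word ss)"
    using f len by (auto simp: fs_def good_def list_all2_conv_all_nth)
  ultimately have "divisible (length fs) (concat (map step_word steps))"
    using occur_in_order_concat[OF sub] assms(2)
    by (intro divisible_if_occur_in_order) (auto simp: fs_def)
  then show ?thesis by (simp add: fs_def)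
qed

section \<open>Cutting words into powers and bounded pieces\<close>

lemma maximal_power:
  assumes "u \<noteq> []"
  shows "\<exists>k v s. r = concat (replicate k u) @ v @ s \<and> strict_prefix v u \<and>
    (s = [] \<or> hd s \<noteq> u ! length v)"
proof (induction r rule: length_induct)
  case (1 r)
  show ?case
  proof (cases "prefix u r")
    case True
    then obtain r' where r: "r = u @ r'" by (auto simp: prefix_def)
    then have "length r' < length r" using assms by simp
    from 1[rule_format, OF this] obtain k v s where
      "r' = concat (replicate k u) @ v @ s" "strict_prefix v u"
      "s = [] \<or> hd s \<noteq> u ! length v" by blast
    with r have "r = concat (replicate (Suc k) u) @ v @ s" "strict_prefix v u"
      "s = [] \<or> hd s \<noteq> u ! length v" by auto
    then show ?thesis by blast
  next
    case False
    \<comment> \<open>No further full copy of \<open>u\<close> fits, so the common prefix is proper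
      in \<open>u\<close>, and by maximality the next letter of \<open>r\<close>, if any, breaks the
      period.\<close>
    define v where "v = longest_common_prefix u r"
    have "prefix v u" "prefix v r"
      unfolding v_def by (rule longest_common_prefix_prefix1 longest_common_prefix_prefix2)+
    then obtain u' s where us: "u = v @ u'" "r = v @ s" by (auto elim!: prefixE)
    have "u' \<noteq> []" using False us by auto
    then obtain y t where u': "u' = y # t" by (cases u') auto
    have "hd s \<noteq> y" if "s \<noteq> []"
    proof
      assume "hd s = y"
      with that obtain s' where "s = y # s'" by (cases s) auto
      then have "prefix (v @ [y]) u" "prefix (v @ [y]) r" using us u' by simp_all
      then have "prefix (v @ [y]) v"
        using longest_common_prefix_max_prefix unfolding v_def by blast
      then show False by (auto dest: prefix_length_le)
    qed
    then have "r = concat (replicate 0 u) @ v @ s \<and> strict_prefix v u \<and>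
        (s = [] \<or> hd s \<noteq> u ! length v)"
      using us u' by (auto simp: strict_prefix_def)
    then show ?thesis by blast
  qed
qed

text \<open>What remains when no step can be cut off: a word too short to guarantee a power, or a
  power whose period is never broken before the end.\<close>

definition short_tail :: "nat \<Rightarrow> nat \<Rightarrow> 'c list \<Rightarrow> bool" where
  "short_tail C n r \<longleftrightarrow> length r < C \<or>
     (\<exists>d u k v. r = d @ concat (replicate k u) @ v \<and> length d \<le> C \<and> 1 \<le> k \<and>
        u \<noteq> [] \<and> length u < n \<and> strict_prefix v u)"

text \<open>A power found near the beginning is made maximal and cut off after its breaking letter.
  The remainder is shorter and again nondivisible, since divisibility passes to any word containing
  it as a factor.\<close>

lemma steps_exist:
  fixes w :: "'c::linorder list"
  assumes C: "\<And>w. set w \<subseteq> A \<Longrightarrow> C \<le> length w \<Longrightarrow> divisible n w \<or>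
    (\<exists>d u r. w = d @ concat (replicate n u) @ r \<and> length d \<le> C \<and> u \<noteq> [] \<and> length u < n)"
    and "set w \<subseteq> A" "\<not> divisible n w" "0 < n"
  shows "\<exists>steps r. w = concat (map step_word steps) @ r \<and> (\<forall>s\<in>set steps. step_ok C n s) \<and>
    short_tail C n r"
  using assms(2,3)
proof (induction w rule: length_induct)
  case (1 w)
  show ?case
  proof (cases "length w < C")
    case True
    then have "w = concat (map step_word []) @ w" "\<forall>s\<in>set []. step_ok C n s" "short_tail C n w"
      by (auto simp: short_tail_def)
    then show ?thesis by blast
  next
    case False
    with C[of w] 1 obtain d u r where w: "w = d @ concat (replicate n u) @ r"
      "length d \<le> C" "u \<noteq> []" "length u < n" by auto
    obtain k v s where r: "r = concat (replicate k u) @ v @ s" "strict_prefix v u"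
      "s = [] \<or> hd s \<noteq> u ! length v" using maximal_power[OF w(3)] by blast
    have w': "w = d @ concat (replicate (n + k) u) @ v @ s" using w r by (simp add: replicate_add)
    show ?thesis
    proof (cases s)
      case Nil
      with w' have "w = d @ concat (replicate (n + k) u) @ v" by simp
      then have "short_tail C n w"
        unfolding short_tail_def using w(2-4) r(2) \<open>0 < n\<close>
        by (intro disjI2 exI[of _ d] exI[of _ u] exI[of _ "n + k"] exI[of _ v]) simp
      moreover have "w = concat (map step_word []) @ w" "\<forall>s\<in>set []. step_ok C n s" by auto
      ultimately show ?thesis by blast
    next
      case (Cons c s')
      define st where "st = (d, u, n + k, v, c)"
      have w'': "w = step_word st @ s'" using w' Cons by (simp add: st_def)
      have ok: "step_ok C n st" using w r Cons by (simp add: st_def)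
      have "length s' < length w" using w'' by (simp add: st_def)
      moreover have "set s' \<subseteq> A" using 1 w'' by simp
      moreover have "\<not> divisible n s'" using 1 w'' divisible_prepend by blast
      ultimately obtain steps r where "s' = concat (map step_word steps) @ r"
        "\<forall>s\<in>set steps. step_ok C n s" "short_tail C n r" using 1 by blast
      with w'' ok have "w = concat (map step_word (st # steps)) @ r"
        "\<forall>s\<in>set (st # steps). step_ok C n s" "short_tail C n r" by auto
      then show ?thesis by blast
    qed
  qed
qed

definition short_power :: "nat \<Rightarrow> 'c list \<Rightarrow> bool" where
  "short_power n w \<longleftrightarrow> (\<exists>u k. w = concat (replicate k u) \<and> 1 \<le> k \<and> u \<noteq> [] \<and> length u < n)"

text \<open>The end \<open>v @ [c]\<close> of a step is carried over as \<open>e\<close> and merged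
  with the \<open>d\<close> of what follows. Thus a step costs two factors and the tail at most
  three, and only the powers can be longer than \<open>C + n\<close>. Empty pieces are filtered out
  because \<open>word_prod []\<close> is a dummy.\<close>

lemma factorization_of_steps:
  assumes "\<forall>s\<in>set steps. step_ok C n s" "short_tail C n r" "length e \<le> n"
  shows "\<exists>ws. concat ws = e @ concat (map step_word steps) @ r \<and> [] \<notin> set ws \<and>
    (\<forall>w\<in>set ws. length w \<le> C + n \<or> short_power n w) \<and> length ws \<le> 2 * length steps + 3 \<and>
    length (filter (\<lambda>w. C + n < length w) ws) \<le> length steps + 1"
  using assms
proof (induction steps arbitrary: e)
  case Nil
  show ?case
  proof (cases "length r < C")
    case True
    with Nil have "concat (filter ((\<noteq>) []) [e @ r]) = e @ concat (map step_word []) @ r \<and>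
      [] \<notin> set (filter ((\<noteq>) []) [e @ r]) \<and>
      (\<forall>w\<in>set (filter ((\<noteq>) []) [e @ r]). length w \<le> C + n \<or> short_power n w) \<and>
      length (filter ((\<noteq>) []) [e @ r]) \<le> 2 * length [] + 3 \<and>
      length (filter (\<lambda>w. C + n < length w) (filter ((\<noteq>) []) [e @ r])) \<le> length [] + 1"
      by auto
    then show ?thesis by (metis list.size(3))
  next
    case False
    with Nil obtain d u k v where r: "r = d @ concat (replicate k u) @ v" "length d \<le> C" "1 \<le> k"
      "u \<noteq> []" "length u < n" "strict_prefix v u" unfolding short_tail_def by blast
    define ws where "ws = filter ((\<noteq>) []) [e @ d, concat (replicate k u), v]"
    have "short_power n (concat (replicate k u))" using r unfolding short_power_def by blast
    moreover have "length v \<le> C + n" using r by (auto dest: prefix_length_less)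
    ultimately have "concat ws = e @ concat (map step_word []) @ r \<and> [] \<notin> set ws \<and>
      (\<forall>w\<in>set ws. length w \<le> C + n \<or> short_power n w) \<and> length ws \<le> 2 * length [] + 3 \<and>
      length (filter (\<lambda>w. C + n < length w) ws) \<le> length [] + 1"
      using r Nil by (auto simp: ws_def)
    then show ?thesis by (metis list.size(3))
  qed
next
  case (Cons st steps)
  obtain d u k v c where st: "st = (d, u, k, v, c)" by (metis prod_cases5)
  with Cons have ok: "step_ok C n (d, u, k, v, c)" by simp
  then have "length (v @ [c]) \<le> n" by (auto dest: prefix_length_less)
  with Cons.IH[of "v @ [c]"] Cons.prems obtain ws where
    ws: "concat ws = (v @ [c]) @ concat (map step_word steps) @ r" "[] \<notin> set ws"
    "\<forall>w\<in>set ws. length w \<le> C + n \<or> short_power n w" "length ws \<le> 2 * length steps + 3"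
    "length (filter (\<lambda>w. C + n < length w) ws) \<le> length steps + 1" by auto
  define ws' where "ws' = filter ((\<noteq>) []) [e @ d, concat (replicate k u)] @ ws"
  have "1 \<le> k" using ok by auto
  then have "short_power n (concat (replicate k u))"
    using ok unfolding short_power_def step_ok.simps by blast
  then have "concat ws' = e @ concat (map step_word (st # steps)) @ r \<and> [] \<notin> set ws' \<and>
      (\<forall>w\<in>set ws'. length w \<le> C + n \<or> short_power n w) \<and> length ws' \<le> 2 * length (st # steps) + 3 \<and>
      length (filter (\<lambda>w. C + n < length w) ws') \<le> length (st # steps) + 1"
    using ws ok Cons.prems(3) st by (auto simp: ws'_def)
  then show ?case by blast
qed

lemma card_short_words:
  assumes "finite A" "0 < n"
  shows "card {u. u \<noteq> [] \<and> set u \<subseteq> A \<and> length u < n} \<le> (card A + 1) ^ (n - 1)"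
proof -
  have "(\<Sum>i\<le>m. l ^ i) \<le> (l + 1) ^ m" for l m :: nat
  proof (induction m)
    case (Suc m)
    have "l ^ m \<le> (l + 1) ^ m" by (simp add: power_mono)
    then have "l * l ^ m \<le> l * (l + 1) ^ m" by (rule mult_le_mono2)
    from add_mono[OF Suc this] show ?case by simp
  qed simp
  moreover have "card {u. u \<noteq> [] \<and> set u \<subseteq> A \<and> length u < n}
      \<le> card {u. set u \<subseteq> A \<and> length u \<le> n - 1}"
    by (rule card_mono) (use assms finite_lists_length_le in auto)
  moreover have "card {u. set u \<subseteq> A \<and> length u \<le> n - 1} = (\<Sum>i\<le>n - 1. card A ^ i)"
    using assms(1) by (rule card_lists_length_le)
  ultimately show ?thesis using order.trans by fastforce
qed

text \<open>With h one more than the bound on the number of steps, the extra one being for a power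
  in the tail, the count 2 * steps + 3 becomes the 2 * h + 1 of
  \<open>height_products\<close>.\<close>

lemma nondivisible_factorization:
  fixes A :: "'c::linorder set"
  assumes "finite A" "0 < n"
  obtains M where "\<And>w. set w \<subseteq> A \<Longrightarrow> \<not> divisible n w \<Longrightarrow>
    \<exists>ws. concat ws = w \<and> [] \<notin> set ws \<and> (\<forall>v\<in>set ws. length v \<le> M \<or> short_power n v) \<and>
      length ws \<le> 2 * (2 * (card A + 1) ^ (n - 1) * (n - 1) + 1) + 1 \<and>
      length (filter (\<lambda>v. M < length v) ws) \<le> 2 * (card A + 1) ^ (n - 1) * (n - 1) + 1"
proof -
  obtain C where C: "\<And>w. set w \<subseteq> A \<Longrightarrow> C \<le> length w \<Longrightarrow> divisible n w \<or>
    (\<exists>d u r. w = d @ concat (replicate n u) @ r \<and> length d \<le> C \<and> u \<noteq> [] \<and> length u < n)"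
    using divisible_or_power[OF assms] by metis
  have "\<exists>ws. concat ws = w \<and> [] \<notin> set ws \<and> (\<forall>v\<in>set ws. length v \<le> C + n \<or> short_power n v) \<and>
      length ws \<le> 2 * (2 * (card A + 1) ^ (n - 1) * (n - 1) + 1) + 1 \<and>
      length (filter (\<lambda>v. C + n < length v) ws) \<le> 2 * (card A + 1) ^ (n - 1) * (n - 1) + 1"
    if w: "set w \<subseteq> A" "\<not> divisible n w" for w
  proof -
    obtain steps r where s: "w = concat (map step_word steps) @ r"
      "\<forall>s\<in>set steps. step_ok C n s" "short_tail C n r"
      using steps_exist[of A C n w, OF C w assms(2)] by blast
    have "\<not> divisible n (concat (map step_word steps))" using w s divisible_append by blast
    moreover have "set (concat (map step_word steps)) \<subseteq> A" using w s by simp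
    ultimately have "length steps \<le> card {u. u \<noteq> [] \<and> set u \<subseteq> A \<and> length u < n} * 2 * (n - 1)"
      using divisible_if_many_steps[OF assms s(2)] by (meson linorder_not_le)
    also have "\<dots> \<le> (card A + 1) ^ (n - 1) * 2 * (n - 1)"
      using card_short_words[OF assms] by (intro mult_le_mono) auto
    finally have "length steps \<le> 2 * (card A + 1) ^ (n - 1) * (n - 1)" by (simp add: mult.commute)
    with factorization_of_steps[OF s(2,3), of "[]"] s(1) show ?thesis by fastforce
  qed
  then show ?thesis using that by blast
qed

section \<open>Spanning by nondivisible words\<close>

lemma word_prod_Cons: "xs \<noteq> [] \<Longrightarrow> word_prod (x # xs) = x * word_prod xs"
  by (cases xs) auto

lemma word_prod_append:
  "xs \<noteq> [] \<Longrightarrow> ys \<noteq> [] \<Longrightarrow> word_prod (xs @ ys) = word_prod xs * word_prod ys"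
proof (induction xs)
  case (Cons x xs)
  then show ?case by (cases "xs = []") (auto simp: word_prod_Cons mult.assoc)
qed simp

lemma word_prod_concat:
  "[] \<notin> set ws \<Longrightarrow> word_prod (map a (concat ws)) = word_prod (map (\<lambda>w. word_prod (map a w)) ws)"
proof (induction ws)
  case (Cons w ws)
  show ?case
  proof (cases "ws = []")
    case False
    then have "map a (concat ws) \<noteq> []" "map a w \<noteq> []"
      using Cons.prems by (cases ws; auto)+
    then have "word_prod (map a (concat (w # ws))) = word_prod (map a w) * word_prod (map a (concat ws))"
      by (simp add: word_prod_append)
    then show ?thesis using Cons.IH Cons.prems False by (simp add: word_prod_Cons)
  qed simp
qed simp

section \<open>Multilinearization of the identity\<close>

context assoc_algebra
begin

text \<open>Distributivity: a list \<open>ps\<close> records which summand is chosen at each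
  position of the monomial \<open>v\<close>.\<close>

lemma word_prod_sum:
  assumes "finite S" "v \<noteq> []"
  shows "word_prod (map (\<lambda>i. \<Sum>p\<in>{p\<in>S. g p = i}. t p) v)
    = (\<Sum>ps\<in>{ps. set ps \<subseteq> S \<and> map g ps = v}. word_prod (map t ps))"
  using assms(2)
proof (induction v)
  case (Cons i v)
  show ?case
  proof (cases "v = []")
    case True
    have eq: "{ps. set ps \<subseteq> S \<and> map g ps = [i]} = (\<lambda>p. [p]) ` {p\<in>S. g p = i}" by auto
    show ?thesis unfolding True eq by (subst sum.reindex) (auto simp: inj_on_def)
  next
    case False
    let ?P = "{p\<in>S. g p = i}" and ?Q = "{ps. set ps \<subseteq> S \<and> map g ps = v}"
    have eq: "{ps. set ps \<subseteq> S \<and> map g ps = i # v} = (\<lambda>(p, ps). p # ps) ` (?P \<times> ?Q)"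
      by (auto simp: map_eq_Cons_conv image_iff)
    have "(\<Sum>ps\<in>{ps. set ps \<subseteq> S \<and> map g ps = i # v}. word_prod (map t ps))
       = (\<Sum>(p, ps)\<in>?P \<times> ?Q. word_prod (map t (p # ps)))"
      unfolding eq by (subst sum.reindex) (auto simp: inj_on_def case_prod_beta)
    also have "\<dots> = (\<Sum>(p, ps)\<in>?P \<times> ?Q. t p * word_prod (map t ps))"
    proof (rule sum.cong[OF refl], clarify)
      fix p ps assume "v = map g ps"
      then show "word_prod (map t (p # ps)) = t p * word_prod (map t ps)"
        using False by (simp add: word_prod_Cons)
    qed
    also have "\<dots> = (\<Sum>p\<in>?P. t p) * (\<Sum>ps\<in>?Q. word_prod (map t ps))"
      by (simp add: sum_product sum.cartesian_product)
    finally show ?thesis using Cons.IH False by (simp add: word_prod_Cons)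
  qed
qed simp

lemma finite_substitution_index:
  assumes "finite T"
  shows "finite {ps. P \<subseteq> set ps \<and> set ps \<subseteq> T \<and> map g ps \<in> Poly_Mapping.keys f}" (is "finite ?S")
proof (rule finite_subset)
  let ?m = "Max (length ` Poly_Mapping.keys f)"
  have "length ps \<le> ?m" if "ps \<in> ?S" for ps
  proof -
    have "length (map g ps) \<in> length ` Poly_Mapping.keys f" using that by blast
    then show ?thesis by (simp add: Max_ge)
  qed
  then show "?S \<subseteq> {ps. set ps \<subseteq> T \<and> length ps \<le> ?m}" by auto
  show "finite {ps. set ps \<subseteq> T \<and> length ps \<le> ?m}"
    using assms by (rule finite_lists_length_le)
qed

text \<open>Substituting \<open>x\<^sub>i = \<Sum> {t\<^sub>p | w\<^sub>p = i}\<close> into the identity turns its monomial \<open>w\<close> into a sum containing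
  \<open>t\<^sub>0 \<cdots> t\<^bsub>n-1\<^esub>\<close>. Setting \<open>t\<^sub>p = 0\<close> and subtracting, for each \<open>p\<close> in turn, leaves the monomials
  in which all of the \<open>t\<^sub>p\<close> occur; by degree reasons these are multilinear.\<close>

lemma partial_linearization:
  assumes id: "polynomial_identity scale f" and "finite T" "finite P"
  shows "(\<Sum>ps\<in>{ps. P \<subseteq> set ps \<and> set ps \<subseteq> T \<and> map g ps \<in> Poly_Mapping.keys f}.
    scale (Poly_Mapping.lookup f (map g ps)) (word_prod (map t ps))) = 0"
  using assms(3,2)
proof (induction P arbitrary: T rule: finite_induct)
  case empty
  let ?K = "Poly_Mapping.keys f"
  let ?S = "{ps. set ps \<subseteq> T \<and> map g ps \<in> ?K}"
  have fin: "finite ?S" using finite_substitution_index[OF empty, of "{}"] by simp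
  \<comment> \<open>Grouping the index lists by their monomial turns the sum into an evaluation of f
    at sums of the \<open>t p\<close>.\<close>
  have "(\<Sum>ps\<in>?S. scale (Poly_Mapping.lookup f (map g ps)) (word_prod (map t ps)))
    = (\<Sum>v\<in>?K. \<Sum>ps\<in>{ps\<in>?S. map g ps = v}.
        scale (Poly_Mapping.lookup f (map g ps)) (word_prod (map t ps)))"
    using fin by (intro sum.group[symmetric]) auto
  also have "\<dots> = (\<Sum>v\<in>?K. scale (Poly_Mapping.lookup f v)
      (word_prod (map (\<lambda>i. \<Sum>p\<in>{p\<in>T. g p = i}. t p) v)))"
  proof (rule sum.cong[OF refl])
    fix v assume v: "v \<in> ?K"
    then have "v \<noteq> []" using id by (auto simp: polynomial_identity_def)
    moreover have "{ps\<in>?S. map g ps = v} = {ps. set ps \<subseteq> T \<and> map g ps = v}" using v by auto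
    ultimately show "(\<Sum>ps\<in>{ps\<in>?S. map g ps = v}.
        scale (Poly_Mapping.lookup f (map g ps)) (word_prod (map t ps)))
      = scale (Poly_Mapping.lookup f v) (word_prod (map (\<lambda>i. \<Sum>p\<in>{p\<in>T. g p = i}. t p) v))"
      using empty by (simp add: word_prod_sum scale_sum_right)
  qed
  also have "\<dots> = nc_eval scale (\<lambda>i. \<Sum>p\<in>{p\<in>T. g p = i}. t p) f"
    by (simp add: nc_eval_def)
  also have "\<dots> = 0" using id by (auto simp: polynomial_identity_def)
  finally show ?case by simp
next
  case (insert p P)
  let ?h = "\<lambda>ps. scale (Poly_Mapping.lookup f (map g ps)) (word_prod (map t ps))"
  let ?S = "\<lambda>P T. {ps. P \<subseteq> set ps \<and> set ps \<subseteq> T \<and> map g ps \<in> Poly_Mapping.keys f}"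
  have fin: "finite (?S P T)" using finite_substitution_index[OF insert.prems] .
  \<comment> \<open>Setting \<open>t p\<close> to zero amounts to deleting p from T, which is why T
    varies in the induction.\<close>
  have "?S (insert p P) T = ?S P T - ?S P (T - {p})" by auto
  then have "sum ?h (?S (insert p P) T) = sum ?h (?S P T) - sum ?h (?S P (T - {p}))"
    using fin by (simp only:) (intro sum_diff, auto)
  then show ?case using insert.IH[of T] insert.IH[of "T - {p}"] insert.prems by simp
qed

text \<open>The variables are indexed by the positions of a leading monomial \<open>w\<close> with
  coefficient 1. A list that uses all n positions and has length at most n is a permutation, and the
  identity permutation reproduces \<open>w\<close>.\<close>

lemma multilinear_identity:
  assumes id: "polynomial_identity scale f" and adm: "admissible f"
  obtains Q \<alpha> where "finite Q" "[0..<nc_degree f] \<in> Q" "\<alpha> [0..<nc_degree f] = 1"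
    "\<And>ps. ps \<in> Q \<Longrightarrow> distinct ps \<and> set ps = {..<nc_degree f}"
    "\<And>t. (\<Sum>ps\<in>Q. scale (\<alpha> ps) (word_prod (map t ps))) = 0"
proof -
  define n where "n = nc_degree f"
  obtain w where w: "w \<in> Poly_Mapping.keys f" "length w = n" "Poly_Mapping.lookup f w = 1"
    using adm by (auto simp: admissible_def n_def)
  define Q where "Q = {ps. {..<n} \<subseteq> set ps \<and> set ps \<subseteq> {..<n} \<and>
    map ((!) w) ps \<in> Poly_Mapping.keys f}"
  define \<alpha> where "\<alpha> ps = Poly_Mapping.lookup f (map ((!) w) ps)" for ps
  have Q: "distinct ps \<and> set ps = {..<n}" if "ps \<in> Q" for ps
  proof -
    have set: "set ps = {..<n}" and "map ((!) w) ps \<in> Poly_Mapping.keys f"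
      using that by (auto simp: Q_def)
    then have "length (map ((!) w) ps) \<le> n"
      unfolding n_def nc_degree_def by (intro Max_ge imageI) auto
    then have "length ps = card (set ps)"
      using set card_length[of ps] by simp
    then show ?thesis using set by (simp add: card_distinct)
  qed
  show thesis
  proof (rule that[of Q \<alpha>])
    have "Q \<subseteq> {ps. set ps \<subseteq> {..<n} \<and> distinct ps}" using Q by auto
    then show "finite Q" using finite_subset finite_subset_distinct by (metis finite_lessThan)
    show "[0..<nc_degree f] \<in> Q" "\<alpha> [0..<nc_degree f] = 1"
      using w by (auto simp: Q_def \<alpha>_def map_nth simp flip: n_def)
    show "\<And>t. (\<Sum>ps\<in>Q. scale (\<alpha> ps) (word_prod (map t ps))) = 0"
      unfolding Q_def \<alpha>_def using id by (intro partial_linearization) auto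
    show "\<And>ps. ps \<in> Q \<Longrightarrow> distinct ps \<and> set ps = {..<nc_degree f}"
      using Q by (simp add: n_def)
  qed
qed

end

text \<open>At the first place where \<open>ps\<close> departs from the identity, all smaller
  indices are used up. A larger index stands there, and its factor is smaller.\<close>

lemma lexless_rearrangement:
  assumes "sorted_wrt (\<lambda>u v. lexless v u) zs" "distinct ps" "set ps = {..<length zs}"
    "ps \<noteq> [0..<length zs]"
  shows "lexless (concat (map ((!) zs) ps)) (concat zs)"
proof -
  let ?n = "length zs"
  have "length ps = length [0..<?n]" using assms(2,3) distinct_card by fastforce
  then obtain q x xs y ys where q: "x \<noteq> y" "ps = q @ [x] @ xs" "[0..<?n] = q @ [y] @ ys"
    using same_length_different[OF assms(4)] by metis
  have "length q < ?n" using arg_cong[OF q(3), of length] by simp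
  then have "y = length q"
    using arg_cong[OF q(3), of "\<lambda>l. l ! length q"] by (simp del: upt_Suc)
  moreover have "q = [0..<length q]"
    using arg_cong[OF q(3), of "take (length q)"] \<open>length q < ?n\<close> by (simp add: take_upt)
  ultimately have "x \<notin> {..<y}" using q(2) assms(2)
    by (metis disjoint_iff distinct_append list.set_intros(1) append_Cons atLeast_upt)
  then have "y < x" using q(1) by auto
  moreover have "x < ?n" using q(2) assms(3) by auto
  ultimately have "lexless (zs ! x) (zs ! y)"
    using sorted_wrt_nth_less[OF assms(1)] by blast
  then have "lexless (concat (map ((!) zs) q) @ zs ! x @ concat (map ((!) zs) xs))
     (concat (map ((!) zs) q) @ zs ! y @ concat (map ((!) zs) ys))"
    by (intro lexless_prepend lexless_append)
  moreover have "concat zs = concat (map ((!) zs) [0..<?n])" by (simp add: map_nth)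
  ultimately show ?thesis using q by simp
qed

lemma length_concat_rearrangement:
  assumes "distinct ps" "set ps = {..<length zs}"
  shows "length (concat (map ((!) zs) ps)) = length (concat zs)"
proof -
  have "length (concat (map ((!) zs) qs)) = (\<Sum>i<length zs. length (zs ! i))"
    if "distinct qs" "set qs = {..<length zs}" for qs
    using that by (simp add: length_concat comp_def sum_list_distinct_conv_sum_set)
  from this[OF assms] this[of "[0..<length zs]"] show ?thesis by (simp add: map_nth atLeast_upt)
qed

section \<open>Rewriting divisible words in the algebra\<close>

context assoc_algebra
begin

text \<open>Concatenation and bilinearity make the span of the words a subalgebra, and it contains
  the generators.\<close>

lemma span_words_eq_UNIV:
  assumes "generates scale (a ` L)"
  shows "span {word_prod (map a w) | w. w \<noteq> [] \<and> set w \<subseteq> L} = UNIV" (is "span ?B = _")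
proof -
  have mult: "x * y \<in> span ?B" if "x \<in> span ?B" "y \<in> span ?B" for x y
    using that(1)
  proof (induction rule: span_induct_alt)
    case base
    then show ?case by (simp add: span_zero)
  next
    case (step c x z)
    then obtain u where u: "x = word_prod (map a u)" "u \<noteq> []" "set u \<subseteq> L" by blast
    have "x * y \<in> span ?B" using that(2)
    proof (induction rule: span_induct_alt)
      case base
      then show ?case by (simp add: span_zero)
    next
      case (step c y z)
      then obtain v where v: "y = word_prod (map a v)" "v \<noteq> []" "set v \<subseteq> L" by blast
      have "x * y = word_prod (map a (u @ v))" using u v by (simp add: word_prod_append)
      then have "x * y \<in> ?B" using u v
        by (intro CollectI exI[of _ "u @ v"]) auto
      then show ?case using step
        by (simp add: distrib_left scale_mult_right span_add span_scale span_base)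
    qed
    then show ?case using step by (simp add: distrib_right scale_mult_left span_add span_scale)
  qed
  then have "subalgebra scale (span ?B)" by (auto simp: subalgebra_def)
  moreover have "a ` L \<subseteq> span ?B"
  proof
    fix x assume "x \<in> a ` L"
    then obtain i where "i \<in> L" "x = word_prod (map a [i])" by auto
    then show "x \<in> span ?B" by (intro span_base CollectI exI[of _ "[i]"]) auto
  qed
  ultimately have "subalgebra scale hull (a ` L) \<subseteq> span ?B" by (simp add: hull_minimal)
  then show ?thesis using assms by (auto simp: generates_def)
qed

text \<open>The multilinear identity is evaluated at the factors \<open>zs\<close> and multiplied by
  \<open>c\<close> and \<open>d\<close>. Every nonidentical permutation gives a smaller word of the
  same length.\<close>

lemma rewrite_divisible:
  fixes a :: "nat \<Rightarrow> 'a"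
  assumes id: "polynomial_identity scale f" and adm: "admissible f" and n: "2 \<le> nc_degree f"
    and "divisible (nc_degree f) w"
  shows "word_prod (map a w) \<in> span {word_prod (map a v) | v.
    v \<noteq> [] \<and> set v \<subseteq> set w \<and> (v, w) \<in> lex {(x, y). x < y}}" (is "_ \<in> span ?B")
proof -
  let ?n = "nc_degree f"
  obtain c zs d where w: "w = c @ concat zs @ d" and len: "length zs = ?n"
    and sorted: "sorted_wrt (\<lambda>u v. lexless v u) zs"
    using assms(4) by (auto simp: divisible_def)
  \<comment> \<open>As n >= 2, every factor is compared with another one and therefore contains a
    letter.\<close>
  have ne: "[] \<notin> set zs"
  proof
    assume "[] \<in> set zs"
    then obtain i where i: "i < ?n" "zs ! i = []" using len by (metis in_set_conv_nth)
    show False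
    proof (cases "i = 0")
      case True
      then have "lexless (zs ! 1) (zs ! i)"
        using sorted_wrt_nth_less[OF sorted, of 0 1] len n by simp
      then show ?thesis using i lexless_not_Nil by blast
    next
      case False
      then have "lexless (zs ! i) (zs ! 0)"
        using sorted_wrt_nth_less[OF sorted, of 0 i] len i by simp
      then show ?thesis using i lexless_not_Nil by blast
    qed
  qed
  obtain Q \<alpha> where Q: "finite Q" "[0..<?n] \<in> Q" "\<alpha> [0..<?n] = 1"
    "\<And>ps. ps \<in> Q \<Longrightarrow> distinct ps \<and> set ps = {..<?n}"
    "\<And>t. (\<Sum>ps\<in>Q. scale (\<alpha> ps) (word_prod (map t ps))) = 0"
    using multilinear_identity[OF id adm] by metis
  define W where "W ps = c @ concat (map ((!) zs) ps) @ d" for ps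
  \<comment> \<open>Without a unit, multiplication by an empty context has to be the identity map by
    cases.\<close>
  define L where "L x = (if c = [] then x else word_prod (map a c) * x)" for x
  define R where "R x = (if d = [] then x else x * word_prod (map a d))" for x
  have ne_ps: "concat (map ((!) zs) ps) \<noteq> []" "[] \<notin> set (map ((!) zs) ps)" if "ps \<in> Q" for ps
  proof -
    have set: "set ps = {..<?n}" using Q that by blast
    show ne': "[] \<notin> set (map ((!) zs) ps)"
    proof
      assume "[] \<in> set (map ((!) zs) ps)"
      then obtain i where "i < length zs" "zs ! i = []" using set len by auto
      then show False using ne by (metis nth_mem)
    qed
    have "0 \<in> set ps" using set n by simp
    then have "zs ! 0 \<in> set (map ((!) zs) ps)" by simp
    then show "concat (map ((!) zs) ps) \<noteq> []" using ne' by (metis concat_eq_Nil_conv)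
  qed
  have word: "word_prod (map a (W ps))
      = L (R (word_prod (map (\<lambda>p. word_prod (map a (zs ! p))) ps)))" if "ps \<in> Q" for ps
    using ne_ps[OF that] word_prod_concat[OF ne_ps(2)[OF that], of a]
    by (auto simp: W_def L_def R_def word_prod_append comp_def)
  have LR: "L (R (scale r x)) = scale r (L (R x))" "L (R (x + y)) = L (R x) + L (R y)" "L (R 0) = 0"
    for r x y
    by (auto simp: L_def R_def scale_mult_left scale_mult_right distrib_left distrib_right)
  have LR_sum: "L (R (sum g S)) = (\<Sum>s\<in>S. L (R (g s)))" for g and S :: "nat list set"
    by (induction S rule: infinite_finite_induct) (auto simp: LR)
  have "(\<Sum>ps\<in>Q. scale (\<alpha> ps) (word_prod (map a (W ps)))) = 0"
    using arg_cong[OF Q(5), of "\<lambda>x. L (R x)"] word by (simp add: LR LR_sum)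
  moreover have "W [0..<?n] = w" using len by (metis W_def w map_nth)
  \<comment> \<open>The identity permutation has coefficient 1, so the term of \<open>w\<close> can
    be isolated without division.\<close>
  ultimately have "word_prod (map a w) + (\<Sum>ps\<in>Q - {[0..<?n]}. scale (\<alpha> ps) (word_prod (map a (W ps)))) = 0"
    using Q(1-3) by (simp add: sum.remove)
  then have "word_prod (map a w) = - (\<Sum>ps\<in>Q - {[0..<?n]}. scale (\<alpha> ps) (word_prod (map a (W ps))))"
    by (simp add: eq_neg_iff_add_eq_0)
  moreover have "word_prod (map a (W ps)) \<in> ?B" if ps: "ps \<in> Q - {[0..<?n]}" for ps
  proof -
    have perm: "distinct ps" "set ps = {..<length zs}" using Q(4) ps len by auto
    have "lexless (concat (map ((!) zs) ps)) (concat zs)"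
      using lexless_rearrangement[OF sorted perm] ps len by simp
    then have "lexless (W ps) w" unfolding W_def w by (intro lexless_prepend lexless_append)
    moreover have "length (W ps) = length w"
      using length_concat_rearrangement[OF perm] by (simp add: W_def w)
    ultimately have "(W ps, w) \<in> lex {(x, y). x < y}" by (rule lexless_imp_lex)
    moreover have "W ps \<noteq> []" using ne_ps ps by (auto simp: W_def)
    moreover have "set (W ps) \<subseteq> set w" using perm by (force simp: W_def w)
    ultimately show ?thesis by blast
  qed
  ultimately show ?thesis by (simp only:) (intro span_neg span_sum span_scale span_base)
qed

lemma span_nondivisible_eq_UNIV:
  fixes a :: "nat \<Rightarrow> 'a"
  assumes "generates scale (a ` L)"
    and "polynomial_identity scale f" "admissible f" "2 \<le> nc_degree f"
  shows "span {word_prod (map a w) | w. w \<noteq> [] \<and> set w \<subseteq> L \<and> \<not> divisible (nc_degree f) w} = UNIV"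
    (is "span ?N = _")
proof -
  have "word_prod (map a w) \<in> span ?N" if "w \<noteq> []" "set w \<subseteq> L" for w
    using that
  proof (induction w rule: wf_induct_rule[OF wf_lex[OF wf_less]])
    case (1 w)
    show ?case
    proof (cases "divisible (nc_degree f) w")
      case True
      then have "word_prod (map a w) \<in> span {word_prod (map a v) | v.
          v \<noteq> [] \<and> set v \<subseteq> set w \<and> (v, w) \<in> lex {(x, y). x < y}}"
        using rewrite_divisible assms by blast
      also have "\<dots> \<subseteq> span ?N" using 1 by (intro span_minimal) auto
      finally show ?thesis .
    next
      case False
      then show ?thesis using 1 by (intro span_base) auto
    qed
  qed
  then have "span {word_prod (map a w) | w. w \<noteq> [] \<and> set w \<subseteq> L} \<subseteq> span ?N"
    by (intro span_minimal) auto
  then show ?thesis using span_words_eq_UNIV[OF assms(1)] by auto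
qed

end

section \<open>The essential height\<close>

context assoc_algebra
begin

lemma essential_height_le:
  fixes a :: "nat \<Rightarrow> 'a"
  assumes "generates scale (a ` {1..l})"
    and "polynomial_identity scale f" "admissible f" "nc_degree f = n" "2 \<le> n"
  shows "essential_height scale (short_words a l n) \<le> enat (2 * (l + 1) ^ (n - 1) * (n - 1) + 1)"
    (is "_ \<le> enat ?h")
proof -
  have "finite {1..l}" "0 < n" using assms by auto
  then obtain M where M: "\<And>w. set w \<subseteq> {1..l} \<Longrightarrow> \<not> divisible n w \<Longrightarrow>
    \<exists>ws. concat ws = w \<and> [] \<notin> set ws \<and> (\<forall>v\<in>set ws. length v \<le> M \<or> short_power n v) \<and>
      length ws \<le> 2 * (2 * (card {1..l} + 1) ^ (n - 1) * (n - 1) + 1) + 1 \<and>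
      length (filter (\<lambda>v. M < length v) ws) \<le> 2 * (card {1..l} + 1) ^ (n - 1) * (n - 1) + 1"
    using nondivisible_factorization[of "{1..l}" n] by metis
  define ev where "ev = (\<lambda>w. word_prod (map a w))"
  \<comment> \<open>The values of all bounded words; the empty word only adds the dummy value
    0.\<close>
  define D where "D = ev ` {w. set w \<subseteq> {1..l} \<and> length w \<le> M}"
  have "finite D" unfolding D_def by (intro finite_imageI finite_lists_length_le) simp
  have "ev w \<in> height_products (short_words a l n) D ?h"
    if w: "w \<noteq> []" "set w \<subseteq> {1..l}" "\<not> divisible n w" for w
  proof -
    obtain ws where ws: "concat ws = w" "[] \<notin> set ws"
      "\<forall>v\<in>set ws. length v \<le> M \<or> short_power n v" "length ws \<le> 2 * ?h + 1"
      "length (filter (\<lambda>v. M < length v) ws) \<le> ?h"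
      using M[OF w(2,3)] unfolding card_atLeastAtMost by auto
    have sub: "set v \<subseteq> {1..l}" if "v \<in> set ws" for v
    proof -
      have "set v \<subseteq> set w" using that unfolding ws(1)[symmetric] by auto
      then show ?thesis using w(2) by (rule subset_trans)
    qed
    have D: "ev v \<in> D" if "v \<in> set ws" "length v \<le> M" for v
      using sub that by (auto simp: D_def)
    have pow: "\<exists>y\<in>short_words a l n. \<exists>k\<ge>1. ev v = word_prod (replicate k y)"
      if v: "v \<in> set ws" "short_power n v" for v
    proof -
      obtain u k where u: "v = concat (replicate k u)" "1 \<le> k" "u \<noteq> []" "length u < n"
        using v(2) by (auto simp: short_power_def)
      have "set u \<subseteq> {1..l}" using sub[OF v(1)] u by auto
      then have "ev u \<in> short_words a l n" using u by (auto simp: short_words_def ev_def)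
      moreover have "ev v = word_prod (replicate k (ev u))"
        using u word_prod_concat[of "replicate k u" a] by (simp add: ev_def map_replicate_const)
      ultimately show ?thesis using u(2) by blast
    qed
    have "ev w = word_prod (map ev ws)"
      using word_prod_concat[OF ws(2), of a] ws(1) by (simp add: ev_def)
    moreover have "map ev ws \<noteq> []" using ws(1) w(1) by auto
    moreover have "length (map ev ws) \<le> 2 * ?h + 1" using ws(4) by simp
    moreover have "\<forall>t\<in>set (map ev ws). t \<in> D \<or>
        (\<exists>y\<in>short_words a l n. \<exists>k\<ge>1. t = word_prod (replicate k y))"
      using ws(3) D pow by fastforce
    moreover have "length (filter (\<lambda>t. t \<notin> D) (map ev ws)) \<le> ?h"
    proof -
      \<comment> \<open>A factor with value outside D is longer than M. The value of a long factor
        may happen to lie in D, so only an inequality of counts results.\<close>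
      have "filter (\<lambda>v. ev v \<notin> D) ws = filter (\<lambda>v. ev v \<notin> D) (filter (\<lambda>v. M < length v) ws)"
        using D by (auto intro!: filter_cong simp: not_less[symmetric])
      then have "length (filter (\<lambda>v. ev v \<notin> D) ws) \<le> length (filter (\<lambda>v. M < length v) ws)"
        by (metis length_filter_le)
      then show ?thesis using ws(5) by (simp add: filter_map comp_def)
    qed
    ultimately show ?thesis unfolding height_products_def by blast
  qed
  then have sub: "{word_prod (map a w) | w. w \<noteq> [] \<and> set w \<subseteq> {1..l} \<and> \<not> divisible n w}
      \<subseteq> height_products (short_words a l n) D ?h"
    unfolding ev_def by blast
  have "span {word_prod (map a w) | w. w \<noteq> [] \<and> set w \<subseteq> {1..l} \<and> \<not> divisible n w} = UNIV"
    by (rule span_nondivisible_eq_UNIV[OF assms(1-3), unfolded assms(4), OF assms(5)])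
  then have "span (height_products (short_words a l n) D ?h) = UNIV"
    using span_mono[OF sub] by (simp only: top.extremum_unique)
  with \<open>finite D\<close> have "enat ?h \<in> {enat h | h. \<exists>D. finite D \<and>
      span (height_products (short_words a l n) D h) = UNIV}" by blast
  then show ?thesis unfolding essential_height_def by (rule Inf_lower)
qed

end

theorem theorem5p1p1:
  fixes scale :: "'r::comm_ring_1 \<Rightarrow> 'a::ring \<Rightarrow> 'a"
    and a :: "nat \<Rightarrow> 'a" and l n :: nat and f :: "'r nc_poly"
  assumes "assoc_algebra scale"
    and "generates scale (a ` {1..l})"
    and "polynomial_identity scale f"
    and "admissible f"
    and "nc_degree f = n"
    and "n \<ge> 2"
  shows "essential_height scale (short_words a l n) < enat (8 * (l + 1) ^ n * n ^ 5 * (n - 1))"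
proof -
  have "2 * (l + 1) ^ (n - 1) * (n - 1) + 1 < 8 * (l + 1) ^ n * n ^ 5 * (n - 1)"
  proof -
    \<comment> \<open>For 1 <= x <= y the left side is at most 3 * y; the stated bound leaves ample
      room.\<close>
    have arith: "2 * x + 1 < 8 * y" if "x \<le> y" "1 \<le> x" for x y :: nat
      using that by linarith
    have "(l + 1) ^ (n - 1) \<le> (l + 1) ^ n" by (rule power_increasing) auto
    moreover have "1 \<le> n ^ 5" using assms(6) by simp
    ultimately have "(l + 1) ^ (n - 1) * 1 * (n - 1) \<le> (l + 1) ^ n * n ^ 5 * (n - 1)"
      by (intro mult_le_mono order_refl)
    then have "(l + 1) ^ (n - 1) * (n - 1) \<le> (l + 1) ^ n * n ^ 5 * (n - 1)"
      by (simp only: mult_1_right)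
    moreover have "1 \<le> (l + 1) ^ (n - 1) * (n - 1)" using assms(6) by simp
    ultimately show ?thesis using arith unfolding mult.assoc by blast
  qed
  then show ?thesis
    using assoc_algebra.essential_height_le[OF assms] by (meson enat_ord_simps(2) order.strict_trans1)
qed

end
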